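(* Suppose that $\mathcal X$ is compact and that, for $j\in\{1,\dots,n\}$, $\mathbb E_{Q_j}[\Phi(\cdot,\xi)]$ and $\mathbb E_{Q_j}[\varphi(\cdot,\xi)]$ are Lipschitz continuous on $\mathcal X$ with moduli $L_{\Phi,j}>0$ and $L_{\varphi,j}>0$, respectively. Then, for any fixed $\hat\theta_N\in\Theta$ and $\hat r_N\ge0$, $\mathbb D\left(\mathfrak X^\lambda(\hat\theta_N,\hat r_N),\mathfrak X(\hat\theta_N,\hat r_N)\right)\to0$ as $\lambda\downarrow0$.
   Context: $\mathcal X\subseteq\mathbb R^d$ is nonempty closed convex with normal cone $\mathcal N_{\mathcal X}(x)=\{v\mid\langle v,y-x\rangle\le0\ \forall y\in\mathcal X\}$. $Q_1,\dots,Q_n$ are fixed probability distributions on $\Xi\subseteq\mathbb R^m$. $\Phi:\mathcal X\times\Xi\to\mathbb R^d$ and $\varphi:\mathcal X\times\Xi\to\mathbb R$ are continuous in $x$ and measurable and $Q_j$-integrable in $\xi$. $\Theta=\{\theta\in\mathbb R^n_+\mid\sum_j\theta_j=1\}$ and $\hat\Theta_N=\{\theta\in\Theta\mid\|\theta-\hat\theta_N\|_\infty\le\hat r_N\}$. For $\lambda\ge0$, $\mathfrak X^\lambda(\hat\theta_N,\hat r_N)$ is the set of $x\in\mathcal X$ for which there exists $\theta\in\arg\max_{\theta'\in\hat\Theta_N}\{\sum_j\theta'_j\mathbb E_{Q_j}[\varphi(x,\xi)]-\lambda\|\theta'\|^2\}$ (Euclidean norm) with $0\in\sum_j\theta_j\mathbb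 E_{Q_j}[\Phi(x,\xi)]+\mathcal N_{\mathcal X}(x)$; $\mathfrak X:=\mathfrak X^0$. $\mathbb D(S_1,S_2)=\sup_{s_1\in S_1}\inf_{s_2\in S_2}\|s_1-s_2\|_\infty$. *)

theory Defs
  imports "HOL-Probability.Probability"
begin

definition normal_cone :: "(real^'d) set \<Rightarrow> real^'d \<Rightarrow> (real^'d) set" where
  "normal_cone X x = {v. \<forall>y\<in>X. v \<bullet> (y - x) \<le> 0}"

text \<open>The measure space of each distribution is \<open>\<Xi>\<close> itself, with the Borel sets of
  \<open>\<real>\<^sup>m\<close> traced on \<open>\<Xi>\<close>.\<close>

definition distribution_on :: "(real^'m) set \<Rightarrow> (real^'m) measure \<Rightarrow> bool" where
  "distribution_on \<Xi> M \<longleftrightarrow> prob_space M \<and> space M = \<Xi> \<and> sets M = sets (restrict_space borel \<Xi>)"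

definition simplex_weights :: "(real^'n) set" where
  "simplex_weights = {\<theta>. (\<forall>j. 0 \<le> \<theta> $ j) \<and> (\<Sum>j\<in>UNIV. \<theta> $ j) = 1}"

definition ambiguity_set :: "real^'n \<Rightarrow> real \<Rightarrow> (real^'n) set" where
  "ambiguity_set \<theta>h rh = {\<theta> \<in> simplex_weights. infnorm (\<theta> - \<theta>h) \<le> rh}"

definition solution_set ::
  "(real^'d) set \<Rightarrow> ('n::finite \<Rightarrow> (real^'m) measure) \<Rightarrow> (real^'d \<Rightarrow> real^'m \<Rightarrow> real^'d) \<Rightarrow>
   (real^'d \<Rightarrow> real^'m \<Rightarrow> real) \<Rightarrow> real^'n \<Rightarrow> real \<Rightarrow> real \<Rightarrow> (real^'d) set" where
  "solution_set X Q \<Phi> \<phi> \<theta>h rh lam =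
    {x \<in> X. \<exists>\<theta>.
       is_arg_max (\<lambda>\<theta>'. (\<Sum>j\<in>UNIV. \<theta>' $ j * (LINT \<xi>|Q j. \<phi> x \<xi>)) - lam * (norm \<theta>')\<^sup>2)
         (\<lambda>\<theta>'. \<theta>' \<in> ambiguity_set \<theta>h rh) \<theta> \<and>
       0 \<in> (+) (\<Sum>j\<in>UNIV. \<theta> $ j *\<^sub>R (LINT \<xi>|Q j. \<Phi> x \<xi>)) ` normal_cone X x}"

text \<open>The one-sided deviation takes values in \<open>[0,\<infinity>]\<close>: it is \<open>0\<close> if \<open>S\<close> is empty, and
  \<open>\<infinity>\<close> if only \<open>T\<close> is.\<close>

definition deviation :: "(real^'d) set \<Rightarrow> (real^'d) set \<Rightarrow> ennreal" where
  "deviation S T = (SUP s\<in>S. INF t\<in>T. ennreal (infnorm (s - t)))"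

end

theory Submission
  imports Defs
begin

text \<open>Approximate solutions with \<open>\<lambda> \<down> 0\<close> stay in the compact set \<open>X\<close>, and their multipliers in the
  compact ambiguity set. Along a convergent subsequence both the maximality of \<open>\<theta>\<close> and the variational
  inequality pass to the limit, because the expectations are continuous in \<open>x\<close>; so every cluster
  point solves the problem with \<open>\<lambda> = 0\<close>. By compactness of \<open>X\<close> this sequential closedness forces the
  one-sided deviation to vanish. In particular the limit set cannot be empty when approximate
  solutions exist for arbitrarily small \<open>\<lambda>\<close>.\<close>

text \<open>If the claim failed, points of \<open>S l\<close> with \<open>l\<close> arbitrarily
  small would keep a fixed distance from \<open>S 0\<close>; a cluster point in \<open>K\<close>
  lies in \<open>S 0\<close> and contradicts this. An empty \<open>S 0\<close> is covered too: the
  infimum over it is infinite, and the cluster point still yields the contradiction.\<close>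

lemma deviation_tendsto_0_if_closed_graph:
  fixes S :: "real \<Rightarrow> (real^'d) set"
  assumes "compact K" and sub: "\<And>l. S l \<subseteq> K"
    and closed_graph: "\<And>l x x0. (\<And>n. 0 < l n) \<Longrightarrow> l \<longlonglongrightarrow> 0 \<Longrightarrow> (\<And>n::nat. x n \<in> S (l n)) \<Longrightarrow> x \<longlonglongrightarrow> x0 \<Longrightarrow> x0 \<in> S 0"
  shows "((\<lambda>l. deviation (S l) (S 0)) \<longlongrightarrow> 0) (at_right 0)"
proof (rule order_tendstoI)
  fix e :: ennreal
  assume "0 < e"
  \<comment> \<open>A supremum that is at least \<open>e\<close> need not be attained, but some
    single point must exceed the strictly smaller \<open>c\<close>.\<close>
  then obtain c where c: "0 < c" "c < e"
    using dense by blast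
  show "\<forall>\<^sub>F l in at_right 0. deviation (S l) (S 0) < e"
  proof (rule ccontr)
    assume "\<not> ?thesis"
    then have neg: "\<exists>l>0. l < b \<and> e \<le> deviation (S l) (S 0)" if "b > 0" for b :: real
      using that unfolding eventually_at_right_field by (metis linorder_not_less)
    have "\<exists>l x. 0 < l \<and> l < inverse (real (Suc n)) \<and> x \<in> S l \<and> c < (INF t\<in>S 0. ennreal (infnorm (x - t)))" for n
    proof -
      obtain l where l: "0 < l" "l < inverse (real (Suc n))" "e \<le> deviation (S l) (S 0)"
        using neg[of "inverse (real (Suc n))"] by auto
      then have "c < deviation (S l) (S 0)"
        using c by order
      then show ?thesis
        using l unfolding deviation_def less_SUP_iff by blast
    qed
    then obtain l x where l: "\<And>n. 0 < l n" "\<And>n. l n < inverse (real (Suc n))"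
      and x: "\<And>n. x n \<in> S (l n)" "\<And>n. c < (INF t\<in>S 0. ennreal (infnorm (x n - t)))"
      by metis
    have "x n \<in> K" for n
      using x sub by blast
    then obtain x0 r where r: "strict_mono (r::nat\<Rightarrow>nat)" "(x \<circ> r) \<longlonglongrightarrow> x0"
      using \<open>compact K\<close> unfolding compact_def by metis
    have "l \<longlonglongrightarrow> 0"
      by (rule tendsto_sandwich[OF _ _ tendsto_const LIMSEQ_inverse_real_of_nat])
        (use l in \<open>auto intro!: always_eventually less_imp_le\<close>)
    then have "(l \<circ> r) \<longlonglongrightarrow> 0"
      using r(1) by (rule LIMSEQ_subseq_LIMSEQ)
    then have x0: "x0 \<in> S 0"
      using l x r(2) by (intro closed_graph[of "l \<circ> r" "x \<circ> r"]) auto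
    have "(\<lambda>n. ennreal (infnorm ((x \<circ> r) n - x0))) \<longlonglongrightarrow> ennreal (infnorm (x0 - x0))"
      using r(2) by (intro tendsto_intros)
    then have "\<forall>\<^sub>F n in sequentially. ennreal (infnorm ((x \<circ> r) n - x0)) < c"
      using c(1) by (intro order_tendstoD(2)) (auto simp: infnorm_0)
    then obtain n where "ennreal (infnorm (x (r n) - x0)) < c"
      by (auto simp: eventually_sequentially)
    \<comment> \<open>The infimum over \<open>S 0\<close> is tested at \<open>x0\<close> itself, to
      which the subsequence converges.\<close>
    moreover have "c < ennreal (infnorm (x (r n) - x0))"
      using x(2) x0 by (rule less_INF_D)
    ultimately show False
      by simp
  qed
\<comment> \<open>The other half of \<open>order_tendstoI\<close> is vacuous: nothing in
  \<open>ennreal\<close> lies below 0.\<close>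
qed simp

lemma compact_ambiguity_set: "compact (ambiguity_set \<theta>h rh)"
proof -
  have "ambiguity_set \<theta>h rh = (\<Inter>j. {\<theta>. 0 \<le> \<theta> $ j}) \<inter> {\<theta>. (\<Sum>j\<in>UNIV. \<theta> $ j) = 1}
      \<inter> {\<theta>. infnorm (\<theta> - \<theta>h) \<le> rh}"
    by (auto simp: ambiguity_set_def simplex_weights_def)
  also have "closed \<dots>"
    by (intro closed_Int closed_INT ballI closed_Collect_le closed_Collect_eq continuous_intros)
  finally have cl: "closed (ambiguity_set \<theta>h rh)" .
  have "norm \<theta> \<le> 1" if "\<theta> \<in> ambiguity_set \<theta>h rh" for \<theta>
  proof -
    \<comment> \<open>Since the weights are nonnegative, this sum of absolute values is their total,
      which is 1.\<close>
    have "norm \<theta> \<le> (\<Sum>j\<in>UNIV. \<bar>\<theta> $ j\<bar>)"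
      by (rule norm_le_l1_cart)
    then show ?thesis
      using that by (auto simp: ambiguity_set_def simplex_weights_def)
  qed
  then have "bounded (ambiguity_set \<theta>h rh)"
    by (auto intro: boundedI)
  with cl show ?thesis
    by (simp add: compact_eq_bounded_closed)
qed

text \<open>Testing at fixed \<open>\<theta>'\<close> and fixed \<open>y\<close> removes the cone,
  which varies with \<open>x\<close>, and leaves only non-strict inequalities, the form that
  survives limits.\<close>

lemma solution_set_iff:
  "x \<in> solution_set X Q \<Phi> \<phi> \<theta>h rh lam \<longleftrightarrow> x \<in> X \<and> (\<exists>\<theta>\<in>ambiguity_set \<theta>h rh.
     (\<forall>\<theta>'\<in>ambiguity_set \<theta>h rh.
        (\<Sum>j\<in>UNIV. \<theta>' $ j * (LINT \<xi>|Q j. \<phi> x \<xi>)) - lam * (norm \<theta>')\<^sup>2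
        \<le> (\<Sum>j\<in>UNIV. \<theta> $ j * (LINT \<xi>|Q j. \<phi> x \<xi>)) - lam * (norm \<theta>)\<^sup>2) \<and>
     (\<forall>y\<in>X. 0 \<le> (\<Sum>j\<in>UNIV. \<theta> $ j *\<^sub>R (LINT \<xi>|Q j. \<Phi> x \<xi>)) \<bullet> (y - x)))"
proof -
  have "0 \<in> (+) a ` normal_cone X x \<longleftrightarrow> (\<forall>y\<in>X. 0 \<le> a \<bullet> (y - x))" for a
  proof -
    have "0 \<in> (+) a ` normal_cone X x \<longleftrightarrow> - a \<in> normal_cone X x"
      by (metis add.right_inverse image_iff minus_unique)
    then show ?thesis
      by (simp add: normal_cone_def)
  qed
  then show ?thesis
    by (auto simp: solution_set_def is_arg_max_linorder)
qed

text \<open>The multipliers need not converge, but compactness of the ambiguity set gives a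
  subsequence along which they do; every defining inequality is then passed to the limit along
  it.\<close>

lemma solution_set_closed_graph:
  fixes Q :: "'n::finite \<Rightarrow> (real^'m) measure" and l :: "nat \<Rightarrow> real"
  assumes "closed X"
    and cont\<Phi>: "\<And>j. continuous_on X (\<lambda>x. LINT \<xi>|Q j. \<Phi> x \<xi>)"
    and cont\<phi>: "\<And>j. continuous_on X (\<lambda>x. LINT \<xi>|Q j. \<phi> x \<xi>)"
    and l: "l \<longlonglongrightarrow> l0" and x: "x \<longlonglongrightarrow> x0"
    and sol: "\<And>n. x n \<in> solution_set X Q \<Phi> \<phi> \<theta>h rh (l n)"
  shows "x0 \<in> solution_set X Q \<Phi> \<phi> \<theta>h rh l0"
proof -
  let ?A = "ambiguity_set \<theta>h rh"
  have xX: "x n \<in> X" for n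
    using sol by (simp add: solution_set_iff)
  with \<open>closed X\<close> x have x0: "x0 \<in> X"
    by (meson closed_sequentially)
  \<comment> \<open>One multiplier must serve both maximality and the variational inequality, so the
    two are bundled before choosing a sequence.\<close>
  define good where "good n \<theta> \<longleftrightarrow> \<theta> \<in> ?A
      \<and> (\<forall>\<theta>'\<in>?A. (\<Sum>j\<in>UNIV. \<theta>' $ j * (LINT \<xi>|Q j. \<phi> (x n) \<xi>)) - l n * (norm \<theta>')\<^sup>2
          \<le> (\<Sum>j\<in>UNIV. \<theta> $ j * (LINT \<xi>|Q j. \<phi> (x n) \<xi>)) - l n * (norm \<theta>)\<^sup>2)
      \<and> (\<forall>y\<in>X. 0 \<le> (\<Sum>j\<in>UNIV. \<theta> $ j *\<^sub>R (LINT \<xi>|Q j. \<Phi> (x n) \<xi>)) \<bullet> (y - x n))" for n \<theta>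
  have "\<exists>\<theta>. good n \<theta>" for n
    using sol[of n] unfolding solution_set_iff good_def by blast
  then obtain \<theta> where good: "\<And>n. good n (\<theta> n)"
    by metis
  then have \<theta>: "\<And>n. \<theta> n \<in> ?A"
    and opt: "\<And>n \<theta>'. \<theta>' \<in> ?A \<Longrightarrow>
        (\<Sum>j\<in>UNIV. \<theta>' $ j * (LINT \<xi>|Q j. \<phi> (x n) \<xi>)) - l n * (norm \<theta>')\<^sup>2
        \<le> (\<Sum>j\<in>UNIV. \<theta> n $ j * (LINT \<xi>|Q j. \<phi> (x n) \<xi>)) - l n * (norm (\<theta> n))\<^sup>2"
    and vi: "\<And>n y. y \<in> X \<Longrightarrow> 0 \<le> (\<Sum>j\<in>UNIV. \<theta> n $ j *\<^sub>R (LINT \<xi>|Q j. \<Phi> (x n) \<xi>)) \<bullet> (y - x n)"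
    unfolding good_def by blast+
  obtain \<theta>0 r where \<theta>0: "\<theta>0 \<in> ?A" and r: "strict_mono (r::nat\<Rightarrow>nat)" "(\<theta> \<circ> r) \<longlonglongrightarrow> \<theta>0"
    using compact_ambiguity_set \<theta> unfolding compact_def by metis
  have \<theta>r: "(\<lambda>n. \<theta> (r n)) \<longlonglongrightarrow> \<theta>0"
    using r(2) by (simp add: o_def)
  have lr: "(\<lambda>n. l (r n)) \<longlonglongrightarrow> l0"
    using LIMSEQ_subseq_LIMSEQ[OF l r(1)] by (simp add: o_def)
  have xr: "(\<lambda>n. x (r n)) \<longlonglongrightarrow> x0"
    using LIMSEQ_subseq_LIMSEQ[OF x r(1)] by (simp add: o_def)
  have \<Phi>r: "(\<lambda>n. LINT \<xi>|Q j. \<Phi> (x (r n)) \<xi>) \<longlonglongrightarrow> (LINT \<xi>|Q j. \<Phi> x0 \<xi>)" for j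
    by (rule continuous_on_tendsto_compose[OF cont\<Phi> xr x0]) (simp add: xX)
  have \<phi>r: "(\<lambda>n. LINT \<xi>|Q j. \<phi> (x (r n)) \<xi>) \<longlonglongrightarrow> (LINT \<xi>|Q j. \<phi> x0 \<xi>)" for j
    by (rule continuous_on_tendsto_compose[OF cont\<phi> xr x0]) (simp add: xX)
  \<comment> \<open>The ambiguity set depends on neither \<open>x\<close> nor \<open>l\<close>, so a
    fixed competitor \<open>\<theta>'\<close> is feasible for every \<open>n\<close>.\<close>
  have "(\<Sum>j\<in>UNIV. \<theta>' $ j * (LINT \<xi>|Q j. \<phi> x0 \<xi>)) - l0 * (norm \<theta>')\<^sup>2
      \<le> (\<Sum>j\<in>UNIV. \<theta>0 $ j * (LINT \<xi>|Q j. \<phi> x0 \<xi>)) - l0 * (norm \<theta>0)\<^sup>2" if "\<theta>' \<in> ?A" for \<theta>'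
  proof (rule LIMSEQ_le)
    show "(\<lambda>n. (\<Sum>j\<in>UNIV. \<theta>' $ j * (LINT \<xi>|Q j. \<phi> (x (r n)) \<xi>)) - l (r n) * (norm \<theta>')\<^sup>2)
      \<longlonglongrightarrow> (\<Sum>j\<in>UNIV. \<theta>' $ j * (LINT \<xi>|Q j. \<phi> x0 \<xi>)) - l0 * (norm \<theta>')\<^sup>2"
      by (intro tendsto_intros \<phi>r lr)
    show "(\<lambda>n. (\<Sum>j\<in>UNIV. \<theta> (r n) $ j * (LINT \<xi>|Q j. \<phi> (x (r n)) \<xi>)) - l (r n) * (norm (\<theta> (r n)))\<^sup>2)
      \<longlonglongrightarrow> (\<Sum>j\<in>UNIV. \<theta>0 $ j * (LINT \<xi>|Q j. \<phi> x0 \<xi>)) - l0 * (norm \<theta>0)\<^sup>2"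
      by (intro tendsto_intros \<phi>r lr \<theta>r)
  qed (use opt[OF that] in blast)
  moreover have "0 \<le> (\<Sum>j\<in>UNIV. \<theta>0 $ j *\<^sub>R (LINT \<xi>|Q j. \<Phi> x0 \<xi>)) \<bullet> (y - x0)" if "y \<in> X" for y
  proof (rule LIMSEQ_le_const)
    show "(\<lambda>n. (\<Sum>j\<in>UNIV. \<theta> (r n) $ j *\<^sub>R (LINT \<xi>|Q j. \<Phi> (x (r n)) \<xi>)) \<bullet> (y - x (r n)))
      \<longlonglongrightarrow> (\<Sum>j\<in>UNIV. \<theta>0 $ j *\<^sub>R (LINT \<xi>|Q j. \<Phi> x0 \<xi>)) \<bullet> (y - x0)"
      by (intro tendsto_intros \<Phi>r \<theta>r xr)
  qed (use vi[OF that] in blast)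
  ultimately show ?thesis
    using x0 \<theta>0 by (auto simp: solution_set_iff)
qed

theorem theorem4:
  fixes X :: "(real^'d) set"
    and \<Xi> :: "(real^'m) set"
    and Q :: "'n::finite \<Rightarrow> (real^'m) measure"
    and \<Phi> :: "real^'d \<Rightarrow> real^'m \<Rightarrow> real^'d"
    and \<phi> :: "real^'d \<Rightarrow> real^'m \<Rightarrow> real"
    and L\<Phi> L\<phi> :: "'n \<Rightarrow> real"
    and \<theta>h :: "real^'n"
    and rh :: real
  assumes "X \<noteq> {}" and "closed X" and "convex X"
    and "\<And>j. distribution_on \<Xi> (Q j)"
    and "\<And>\<xi>. \<xi> \<in> \<Xi> \<Longrightarrow> continuous_on X (\<lambda>x. \<Phi> x \<xi>)"
    and "\<And>\<xi>. \<xi> \<in> \<Xi> \<Longrightarrow> continuous_on X (\<lambda>x. \<phi> x \<xi>)"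
    and "\<And>x. x \<in> X \<Longrightarrow> \<Phi> x \<in> borel_measurable (restrict_space borel \<Xi>)"
    and "\<And>x. x \<in> X \<Longrightarrow> \<phi> x \<in> borel_measurable (restrict_space borel \<Xi>)"
    and "\<And>j x. x \<in> X \<Longrightarrow> integrable (Q j) (\<Phi> x)"
    and "\<And>j x. x \<in> X \<Longrightarrow> integrable (Q j) (\<phi> x)"
    and "compact X"
    and "\<And>j. L\<Phi> j > 0" and "\<And>j. L\<phi> j > 0"
    and "\<And>j. (L\<Phi> j)-lipschitz_on X (\<lambda>x. LINT \<xi>|Q j. \<Phi> x \<xi>)"
    and "\<And>j. (L\<phi> j)-lipschitz_on X (\<lambda>x. LINT \<xi>|Q j. \<phi> x \<xi>)"
    and "\<theta>h \<in> simplex_weights" and "rh \<ge> 0"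
  shows "((\<lambda>lam. deviation (solution_set X Q \<Phi> \<phi> \<theta>h rh lam) (solution_set X Q \<Phi> \<phi> \<theta>h rh 0))
           \<longlongrightarrow> 0) (at_right 0)"
proof (rule deviation_tendsto_0_if_closed_graph[OF \<open>compact X\<close>])
  show "solution_set X Q \<Phi> \<phi> \<theta>h rh l \<subseteq> X" for l
    by (auto simp: solution_set_def)
next
  fix l x x0
  assume "l \<longlonglongrightarrow> 0" and "\<And>n::nat. x n \<in> solution_set X Q \<Phi> \<phi> \<theta>h rh (l n)" and "x \<longlonglongrightarrow> x0"
  then show "x0 \<in> solution_set X Q \<Phi> \<phi> \<theta>h rh 0"
    \<comment> \<open>The Lipschitz bounds supply the continuity of the expectations on
      \<open>X\<close>.\<close>
    by (intro solution_set_closed_graph[of X Q \<Phi> \<phi> l 0 x] \<open>closed X\<close>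
        lipschitz_on_continuous_on[OF assms(14)] lipschitz_on_continuous_on[OF assms(15)])
qed

end
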